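(* For all integers $r\geq 2$ and $k\geq 4$, \begin{align*} w_r(k)\geq\;& (r-2)\,r!\left((e_r-1)\frac{(r!)^{k-3}-1}{r!-1}-(r!)^{k-4}\right)\\ &+\sum_{j=0}^{r-3}\binom{r}{j}\binom{r(k-3)+j-1}{\underbrace{k-2,\dots,k-2}_{j},\underbrace{k-3,\dots,k-3}_{r-j-1},k-4}(r-j)\left[r-j-2+w_{r-j}(3)\right]. \end{align*}
   Context: For each integer $r\geq 2$, $w_r:\mathbb{Z}_{\geq 2}^r\to\mathbb{Z}_{\geq 0}$ denotes the family of functions uniquely determined by: (i) $w_2(k_1,k_2)=0$ for $k_1,k_2\geq 2$; (ii) for $r\geq 2$ and $k_1,\dots,k_r\geq 2$, inserting a coordinate equal to $2$ at any position of $(k_1,\dots,k_r)$ gives an $(r+1)$-tuple at which $w_{r+1}$ equals $w_r(k_1,\dots,k_r)$; (iii) for $k_1,\dots,k_r\geq 3$, $w_r(k_1,\dots,k_r)=\sum_{i=1}^r w_r(k_1,\dots,k_i-1,\dots,k_r)+(r-2)$ (the $i$-th coordinate decreased by $1$). $w_r(k)$ means $w_r(k,\dots,k)$. $e_r=\sum_{n=0}^r\frac{1}{n!}$. The multinomial coefficient $\binom{n}{a_1,\dots,a_r}$ equals $\frac{n!}{a_1!\cdots a_r!}$. *)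

theory Defs
  imports Complex_Main
begin

text \<open>Tuples in \<open>\<int>\<^bsub>\<ge>2\<^esub>\<^sup>r\<close> are lists of length \<open>r\<close> with entries \<open>\<ge> 2\<close>; the values of
  \<open>w r\<close> on other lists are left unconstrained.\<close>

definition w_family :: "(nat \<Rightarrow> nat list \<Rightarrow> nat) \<Rightarrow> bool" where
  "w_family w \<longleftrightarrow>
     (\<forall>k1 k2. 2 \<le> k1 \<and> 2 \<le> k2 \<longrightarrow> w 2 [k1, k2] = 0) \<and>
     (\<forall>r xs ys. 2 \<le> r \<and> length (xs @ ys) = r \<and> (\<forall>k\<in>set (xs @ ys). 2 \<le> k) \<longrightarrow>
        w (r + 1) (xs @ 2 # ys) = w r (xs @ ys)) \<and>
     (\<forall>r ks. 2 \<le> r \<and> length ks = r \<and> (\<forall>k\<in>set ks. 3 \<le> k) \<longrightarrow>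
        w r ks = (\<Sum>i<r. w r (ks[i := ks ! i - 1])) + (r - 2))"

definition e_sum :: "nat \<Rightarrow> real" where
  "e_sum r = (\<Sum>n=0..r. 1 / fact n)"

definition multinomial :: "nat \<Rightarrow> nat list \<Rightarrow> real" where
  "multinomial n as = fact n / prod_list (map fact as)"

text \<open>The conditions in \<open>w_family\<close> are consistent and determine the family on its domain.\<close>

lemma w_family_unique:
  assumes "w_family w" "w_family w'"
    and "2 \<le> r" "length ks = r" "\<forall>k\<in>set ks. 2 \<le> k"
  shows "w r ks = w' r ks"
  using assms(3-)
proof (induction "sum_list ks" arbitrary: r ks rule: less_induct)
  case less
  consider "r = 2" | "r > 2" "2 \<in> set ks" | "r > 2" "2 \<notin> set ks"
    using less.prems by linarith
  then show ?case
  proof cases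
    case 1
    then obtain k1 k2 where "ks = [k1, k2]"
      using less.prems(2) by (metis (no_types) length_0_conv length_Suc_conv numeral_2_eq_2)
    with less.prems 1 assms(1,2) show ?thesis
      by (simp add: w_family_def)
  next
    case 2
    then obtain xs ys where ks: "ks = xs @ 2 # ys"
      by (meson split_list)
    have len: "r = length (xs @ ys) + 1" "2 \<le> length (xs @ ys)" "\<forall>k\<in>set (xs @ ys). 2 \<le> k"
      using less.prems 2 ks by auto
    have "w (length (xs @ ys)) (xs @ ys) = w' (length (xs @ ys)) (xs @ ys)"
      by (rule less.hyps) (use len ks in auto)
    moreover have "v r ks = v (length (xs @ ys)) (xs @ ys)" if "w_family v" for v
      using that len unfolding w_family_def ks by blast
    ultimately show ?thesis
      using assms(1,2) by (metis (no_types))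
  next
    case 3
    have ge3: "\<forall>k\<in>set ks. 3 \<le> k"
      using 3 less.prems(3) by (metis Suc_leI le_neq_implies_less numeral_2_eq_2 numeral_3_eq_3)
    have "w r (ks[i := ks ! i - 1]) = w' r (ks[i := ks ! i - 1])" if i: "i < r" for i
    proof (rule less.hyps)
      have ge: "3 \<le> ks ! i"
        using ge3 i less.prems(2) by simp
      then show "\<forall>k\<in>set (ks[i := ks ! i - 1]). 2 \<le> k"
        using less.prems(3) set_update_subset_insert[of ks i "ks ! i - 1"] by fastforce
      have "ks ! i \<le> sum_list ks"
        using i less.prems(2) by (simp add: elem_le_sum_list)
      then show "sum_list (ks[i := ks ! i - 1]) < sum_list ks"
        using i less.prems(2) ge by (simp add: sum_list_update)
    qed (use less.prems in auto)
    moreover have step: "v r ks = (\<Sum>i<r. v r (ks[i := ks ! i - 1])) + (r - 2)" if "w_family v" for v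
      using that ge3 less.prems unfolding w_family_def by blast
    ultimately show ?thesis
      by (simp add: step[OF assms(1)] step[OF assms(2)])
  qed
qed

function w_rec :: "nat list \<Rightarrow> nat" where
  "w_rec ks = (let ls = filter (\<lambda>k. 2 < k) ks in
     if length ls \<le> 2 then 0
     else (\<Sum>i<length ls. w_rec (ls[i := ls ! i - 1])) + (length ls - 2))"
  by auto
termination
proof (relation "measure sum_list")
  fix ks ls :: "nat list" and i :: nat
  assume ls: "ls = filter (\<lambda>k. 2 < k) ks" and "i \<in> {..<length ls}"
  then have i: "i < length ls" by simp
  have "2 < ls ! i"
    using nth_mem[OF i] ls by simp
  moreover have "ls ! i \<le> sum_list ls"
    using i by (simp add: elem_le_sum_list)
  ultimately have "sum_list (ls[i := ls ! i - 1]) < sum_list ls"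
    using i by (simp add: sum_list_update)
  also have "sum_list ls \<le> sum_list ks"
    unfolding ls by (induction ks) auto
  finally show "(ls[i := ls ! i - 1], ks) \<in> measure sum_list" by simp
qed simp

declare w_rec.simps [simp del]

lemma w_family_exists: "w_family (\<lambda>r. w_rec)"
  unfolding w_family_def
proof (intro conjI allI impI)
  fix k1 k2 :: nat
  show "w_rec [k1, k2] = 0"
    by (subst w_rec.simps) (simp add: Let_def)
next
  fix r :: nat and xs ys :: "nat list"
  show "w_rec (xs @ 2 # ys) = w_rec (xs @ ys)"
    by (subst (1 2) w_rec.simps) simp
next
  fix r :: nat and ks :: "nat list"
  assume *: "2 \<le> r \<and> length ks = r \<and> (\<forall>k\<in>set ks. 3 \<le> k)"
  then have filter: "filter (\<lambda>k. 2 < k) ks = ks"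
    by (intro filter_True) auto
  show "w_rec ks = (\<Sum>i<r. w_rec (ks[i := ks ! i - 1])) + (r - 2)"
  proof (cases "r = 2")
    case True
    have "w_rec ls = 0" if "length ls = 2" for ls
      using length_filter_le[of "\<lambda>k. 2 < k" ls] that
      by (subst w_rec.simps) (simp add: Let_def)
    then show ?thesis
      using * True by simp
  next
    case False
    then show ?thesis
      using * filter by (subst w_rec.simps) (simp add: Let_def)
  qed
qed

end

theory Submission
  imports Defs
begin

text \<open>
  Shift all entries by \<open>2\<close>. Unfolding the recurrence, \<open>w\<^sub>r\<close> at a point counts the lattice paths
  that start there and repeatedly lower a positive coordinate, each visited point with \<open>a\<close> positive
  coordinates contributing \<open>max 0 (a - 2)\<close>. Two disjoint families of contributions are
  kept. The multinomial sum collects the paths that pass through a point \<open>z\<close> having one coordinate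
  \<open>2\<close> and all others \<open>0\<close> or \<open>1\<close>: the contribution of \<open>z\<close> itself, and everything that follows after
  the coordinate \<open>2\<close> is lowered. The first summand collects the contributions, at the remaining
  points, of the paths that visit every diagonal point \<open>(c, \<dots>, c)\<close>. Both bounds follow by
  induction along the recurrence, without ever introducing paths.
\<close>

section \<open>The recurrence in the presence of entries equal to 2\<close>

lemma w_rec_filter: "w_rec (filter (\<lambda>k. 2 < k) ks) = w_rec ks"
  by (subst (1 2) w_rec.simps) simp

lemma w_rec_eq_0: "length (filter (\<lambda>k. 2 < k) ks) \<le> 2 \<Longrightarrow> w_rec ks = 0"
  by (subst w_rec.simps) (simp add: Let_def)

text \<open>Lowering an entry above 2 commutes with discarding the 2s, up to renumbering positions.
  \<open>F\<close> is arbitrary so that the induction can absorb a retained head into it.\<close>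

lemma sum_filter_update:
  fixes F :: "nat list \<Rightarrow> nat"
  shows "(\<Sum>i<length ks. if 2 < ks ! i then F (filter (\<lambda>k. 2 < k) (ks[i := ks ! i - 1])) else 0) =
    (\<Sum>i<length (filter (\<lambda>k. 2 < k) ks). F (filter (\<lambda>k. 2 < k)
       ((filter (\<lambda>k. 2 < k) ks)[i := filter (\<lambda>k. 2 < k) ks ! i - 1])))"
proof (induction ks arbitrary: F)
  case (Cons a ks)
  show ?case
  proof (cases "2 < a")
    case True
    then show ?thesis
      using Cons.IH[of "\<lambda>l. F (a # l)"]
      by (simp add: sum.lessThan_Suc_shift del: sum.lessThan_Suc cong: if_cong)
  next
    case False
    then show ?thesis
      using Cons.IH[of F]
      by (simp add: sum.lessThan_Suc_shift del: sum.lessThan_Suc cong: if_cong)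
  qed
qed simp

text \<open>Since 2s can be discarded on both sides, the recurrence holds at fixed length with the
  entries 2 frozen. If at most two entries exceed 2, truncated subtraction makes the last term 0 and
  everything vanishes.\<close>

lemma w_rec_step:
  "w_rec ks = (\<Sum>i<length ks. if 2 < ks ! i then w_rec (ks[i := ks ! i - 1]) else 0)
     + (length (filter (\<lambda>k. 2 < k) ks) - 2)"
proof -
  define ls where "ls = filter (\<lambda>k. 2 < k) ks"
  have "(\<Sum>i<length ks. if 2 < ks ! i then w_rec (ks[i := ks ! i - 1]) else 0)
      = (\<Sum>i<length ls. w_rec (ls[i := ls ! i - 1]))"
    using sum_filter_update[of ks w_rec] unfolding w_rec_filter ls_def .
  moreover have "w_rec ks = (\<Sum>i<length ls. w_rec (ls[i := ls ! i - 1])) + (length ls - 2)"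
  proof (cases "length ls \<le> 2")
    case True
    then have "w_rec (ls[i := ls ! i - 1]) = 0" for i
      by (intro w_rec_eq_0 order.trans[OF length_filter_le]) simp
    moreover have "w_rec ks = 0"
      using True w_rec_eq_0 ls_def by simp
    ultimately show ?thesis
      using True by simp
  next
    case False
    then show ?thesis
      by (subst w_rec.simps) (simp add: Let_def flip: ls_def)
  qed
  ultimately show ?thesis
    by (simp add: ls_def)
qed

definition active :: "nat \<Rightarrow> (nat \<Rightarrow> nat) \<Rightarrow> nat set" where
  "active r x = {i. i < r \<and> 0 < x i}"

definition W :: "nat \<Rightarrow> (nat \<Rightarrow> nat) \<Rightarrow> real" where
  "W r x = real (w_rec (map (\<lambda>i. x i + 2) [0..<r]))"

lemma finite_active [simp]: "finite (active r x)"
  by (simp add: active_def)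

lemma W_cong: "(\<And>i. i < r \<Longrightarrow> x i = y i) \<Longrightarrow> W r x = W r y"
  unfolding W_def by (intro arg_cong[where f = "\<lambda>l. real (w_rec l)"] map_cong) auto

lemma W_step:
  "W r x = (\<Sum>i\<in>active r x. W r (x(i := x i - 1))) + real (card (active r x) - 2)"
proof -
  define ks where "ks = map (\<lambda>i. x i + 2) [0..<r]"
  have upd: "ks[i := ks ! i - 1] = map (\<lambda>l. (x(i := x i - 1)) l + 2) [0..<r]"
    if "i < r" "0 < x i" for i
    using that by (intro nth_equalityI) (auto simp: ks_def nth_list_update)
  have len: "length (filter (\<lambda>k. 2 < k) ks) = card (active r x)"
    by (simp add: length_filter_conv_card ks_def active_def cong: conj_cong)
  have "w_rec ks = (\<Sum>i<r. if 0 < x i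
      then w_rec (map (\<lambda>l. (x(i := x i - 1)) l + 2) [0..<r]) else 0) + (card (active r x) - 2)"
    unfolding w_rec_step[of ks] len
    by (intro arg_cong2[where f = "(+)"] sum.cong refl)
       (auto simp: upd simp del: One_nat_def, auto simp: ks_def)
  also have "(\<Sum>i<r. if 0 < x i then w_rec (map (\<lambda>l. (x(i := x i - 1)) l + 2) [0..<r]) else 0)
     = (\<Sum>i\<in>active r x. w_rec (map (\<lambda>l. (x(i := x i - 1)) l + 2) [0..<r]))"
    by (intro sum.mono_neutral_cong_right) (auto simp: active_def)
  finally show ?thesis
    by (simp add: W_def ks_def)
qed

section \<open>Counting paths between two points\<close>

text \<open>The multinomial number of lattice paths descending from \<open>x\<close> to
  \<open>z\<close> by unit steps.\<close>

definition paths :: "nat \<Rightarrow> (nat \<Rightarrow> nat) \<Rightarrow> (nat \<Rightarrow> nat) \<Rightarrow> real" where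
  "paths r x z = (if \<forall>i<r. z i \<le> x i
     then fact (\<Sum>i<r. x i - z i) / (\<Prod>i<r. fact (x i - z i)) else 0)"

lemma paths_nonneg: "0 \<le> paths r x z"
  by (auto simp: paths_def intro!: divide_nonneg_nonneg prod_nonneg)

lemma paths_refl: "(\<And>i. i < r \<Longrightarrow> x i = z i) \<Longrightarrow> paths r x z = 1"
  by (simp add: paths_def)

text \<open>Keeping the denominator of \<open>paths r x z\<close> makes summation over
  \<open>i\<close> immediate: the factors \<open>x i - z i\<close> add up to the path
  length.\<close>

lemma paths_lower_coordinate:
  assumes le: "\<forall>i<r. z i \<le> x i" and i: "i < r" "z i < x i"
  shows "paths r (x(i := x i - 1)) z
    = fact ((\<Sum>l<r. x l - z l) - 1) * real (x i - z i) / (\<Prod>l<r. fact (x l - z l))"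
proof -
  let ?x' = "x(i := x i - 1)"
  define d where "d = x i - z i - 1"
  have d: "x i - z i = Suc d" "x i - Suc (z i) = d"
    using i by (auto simp: d_def)
  have sum: "(\<Sum>l<r. ?x' l - z l) = (\<Sum>l<r. x l - z l) - 1"
    using i(1) by (simp add: sum.remove[of "{..<r}" i] d)
  have prod: "(\<Prod>l<r. fact (x l - z l)) = real (Suc d) * (\<Prod>l<r. fact (?x' l - z l))"
    using i by (simp add: prod.remove[of "{..<r}" i] d algebra_simps)
  have "\<forall>l<r. z l \<le> ?x' l"
    using le i by auto
  then show ?thesis
    unfolding paths_def prod d sum by (simp del: of_nat_Suc)
qed

text \<open>Pascal's rule for multinomials, splitting by the first step; the \<open>of_bool\<close>
  term is the empty path. For the inequality, nonnegativity disposes of steps to points not above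
  \<open>z\<close>.\<close>

lemma paths_step:
  "paths r x z \<le> (\<Sum>i\<in>active r x. paths r (x(i := x i - 1)) z)
     + of_bool (\<forall>i<r. x i = z i)"
proof (cases "\<forall>i<r. z i \<le> x i")
  case False
  then have "paths r x z = 0"
    unfolding paths_def by (rule if_not_P)
  then show ?thesis
    by (simp add: paths_nonneg sum_nonneg)
next
  case le: True
  show ?thesis
  proof (cases "\<forall>i<r. x i = z i")
    case True
    then show ?thesis
      by (simp add: paths_refl paths_nonneg sum_nonneg)
  next
    case False
    define n where "n = (\<Sum>l<r. x l - z l)"
    define p :: real where "p = (\<Prod>l<r. fact (x l - z l))"
    from False le obtain i where "i < r" "z i < x i"
      by (metis le_neq_implies_less)
    then have "n \<noteq> 0"
      unfolding n_def by (auto simp: not_le)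
    have "paths r x z = fact n / p"
      using le by (simp add: paths_def n_def p_def)
    also have "\<dots> = fact (n - 1) * real n / p"
      using \<open>n \<noteq> 0\<close> by (simp add: fact_reduce mult.commute)
    also have "\<dots> = (\<Sum>i<r. fact (n - 1) * real (x i - z i) / p)"
      by (simp add: n_def sum_distrib_left sum_divide_distrib)
    also have "\<dots> = (\<Sum>i\<in>{i. i < r \<and> z i < x i}. fact (n - 1) * real (x i - z i) / p)"
      by (intro sum.mono_neutral_right) auto
    also have "\<dots> = (\<Sum>i\<in>{i. i < r \<and> z i < x i}. paths r (x(i := x i - 1)) z)"
      using paths_lower_coordinate[OF le] by (intro sum.cong) (simp_all add: n_def p_def)
    also have "\<dots> \<le> (\<Sum>i\<in>active r x. paths r (x(i := x i - 1)) z)"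
      by (intro sum_mono2) (auto simp: active_def paths_nonneg)
    finally show ?thesis
      using False by simp
  qed
qed

section \<open>Contributions at the boundary of the unit cube\<close>

text \<open>\<open>J\<close> holds the zeros, the second component is the position of the 2. The
  bound on \<open>card J\<close> leaves at least three positive coordinates.\<close>

definition gates :: "nat \<Rightarrow> (nat set \<times> nat) set" where
  "gates r = (SIGMA J:{J. J \<subseteq> {..<r} \<and> card J < r - 2}. {..<r} - J)"

definition gate_point :: "nat set \<times> nat \<Rightarrow> nat \<Rightarrow> nat" where
  "gate_point p l = (if l \<in> fst p then 0 else if l = snd p then 2 else 1)"

text \<open>The contribution of the gate itself, plus the value at the point reached by lowering the
  2 to 1: its \<open>r - card J\<close> ones are entries 3 of \<open>w_rec\<close>.\<close>

definition gate_gain :: "nat \<Rightarrow> nat set \<times> nat \<Rightarrow> real" where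
  "gate_gain r p = real r - real (card (fst p)) - 2
     + real (w_rec (replicate (r - card (fst p)) 3))"

definition gate_sum :: "nat \<Rightarrow> (nat \<Rightarrow> nat) \<Rightarrow> real" where
  "gate_sum r x = (\<Sum>p\<in>gates r. paths r x (gate_point p) * gate_gain r p)"

lemma gate_sum_cong: "(\<And>i. i < r \<Longrightarrow> x i = y i) \<Longrightarrow> gate_sum r x = gate_sum r y"
  by (simp add: gate_sum_def paths_def cong: sum.cong_simp prod.cong_simp if_cong)

lemma finite_gates: "finite (gates r)"
  unfolding gates_def by (intro finite_SigmaI) auto

lemma gate_gain_nonneg: "p \<in> gates r \<Longrightarrow> 0 \<le> gate_gain r p"
  by (auto simp: gates_def gate_gain_def)

text \<open>The positions of 0 and 2 determine the gate, so a point collects the gain of at most one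
  gate.\<close>

lemma gate_point_inj:
  assumes p: "p \<in> gates r" and q: "q \<in> gates r"
    and eq: "\<forall>i<r. gate_point p i = gate_point q i"
  shows "p = q"
proof -
  have sub: "fst p \<subseteq> {..<r}" "fst q \<subseteq> {..<r}" "snd p < r" "snd q < r"
    "snd p \<notin> fst p" "snd q \<notin> fst q"
    using p q by (auto simp: gates_def)
  have "l \<in> fst p \<longleftrightarrow> l \<in> fst q" if "l < r" for l
    using eq[rule_format, OF that] by (auto simp: gate_point_def split: if_splits)
  then have "fst p = fst q"
    using sub by blast
  moreover have "snd p = snd q"
    using eq[rule_format, OF sub(3)] sub by (auto simp: gate_point_def split: if_splits)
  ultimately show ?thesis
    by (simp add: prod_eq_iff)
qed

lemma gate_sum_step:
  "gate_sum r x \<le> (\<Sum>i\<in>active r x. gate_sum r (x(i := x i - 1)))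
     + (\<Sum>p\<in>gates r. of_bool (\<forall>i<r. x i = gate_point p i) * gate_gain r p)"
proof -
  have "gate_sum r x \<le> (\<Sum>p\<in>gates r. ((\<Sum>i\<in>active r x. paths r (x(i := x i - 1)) (gate_point p))
     + of_bool (\<forall>i<r. x i = gate_point p i)) * gate_gain r p)"
    unfolding gate_sum_def by (intro sum_mono mult_right_mono paths_step gate_gain_nonneg)
  also have "\<dots> = (\<Sum>p\<in>gates r. \<Sum>i\<in>active r x. paths r (x(i := x i - 1)) (gate_point p) * gate_gain r p)
     + (\<Sum>p\<in>gates r. of_bool (\<forall>i<r. x i = gate_point p i) * gate_gain r p)"
    by (simp add: distrib_right sum.distrib sum_distrib_right)
  also have "(\<Sum>p\<in>gates r. \<Sum>i\<in>active r x. paths r (x(i := x i - 1)) (gate_point p) * gate_gain r p)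
     = (\<Sum>i\<in>active r x. gate_sum r (x(i := x i - 1)))"
    unfolding gate_sum_def by (rule sum.swap)
  finally show ?thesis .
qed

lemma gate_sum_step_off_gates:
  assumes "\<And>p. p \<in> gates r \<Longrightarrow> \<exists>i<r. x i \<noteq> gate_point p i"
  shows "gate_sum r x \<le> (\<Sum>i\<in>active r x. gate_sum r (x(i := x i - 1)))"
proof -
  have "(\<Sum>p\<in>gates r. of_bool (\<forall>i<r. x i = gate_point p i) * gate_gain r p) = 0"
    using assms by (intro sum.neutral) auto
  then show ?thesis
    using gate_sum_step[of r x] by simp
qed

lemma gate_sum_step_at_gate:
  assumes p: "p \<in> gates r" and x: "\<forall>i<r. x i = gate_point p i"
  shows "gate_sum r x \<le> (\<Sum>i\<in>active r x. gate_sum r (x(i := x i - 1))) + gate_gain r p"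
proof -
  have "(\<Sum>q\<in>gates r. of_bool (\<forall>i<r. x i = gate_point q i) * gate_gain r q)
     = (\<Sum>q\<in>{p}. of_bool (\<forall>i<r. x i = gate_point q i) * gate_gain r q)"
  proof (intro sum.mono_neutral_right finite_gates ballI)
    fix q assume "q \<in> gates r - {p}"
    then have "\<not> (\<forall>i<r. x i = gate_point q i)"
      using gate_point_inj[OF p, of q] x by auto
    then show "of_bool (\<forall>i<r. x i = gate_point q i) * gate_gain r q = 0"
      by simp
  qed (use p in auto)
  then show ?thesis
    using gate_sum_step[of r x] x by simp
qed

text \<open>A gate has a coordinate 2, so no point of the cube lies above it. Hence nothing after
  the lowering of the 2 is counted twice.\<close>

lemma gate_sum_unit_cube:
  assumes "\<forall>i<r. x i \<le> 1"
  shows "gate_sum r x = 0"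
  unfolding gate_sum_def
proof (intro sum.neutral ballI)
  fix p assume "p \<in> gates r"
  then have "snd p < r" "gate_point p (snd p) = 2"
    by (auto simp: gates_def gate_point_def)
  then have "\<not> (\<forall>i<r. gate_point p i \<le> x i)"
    using assms by fastforce
  then have "paths r x (gate_point p) = 0"
    unfolding paths_def by (rule if_not_P)
  then show "paths r x (gate_point p) * gate_gain r p = 0"
    by simp
qed

lemma W_unit_cube:
  assumes J: "J \<subseteq> {..<r}" and x: "\<And>i. i < r \<Longrightarrow> x i = (if i \<in> J then 0 else 1)"
  shows "W r x = real (w_rec (replicate (r - card J) 3))"
proof -
  let ?ks = "map (\<lambda>i. x i + 2) [0..<r]"
  have "{i. i < r \<and> 2 < ?ks ! i} = {..<r} - J"
    using x by (auto split: if_splits)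
  then have "length (filter (\<lambda>k. 2 < k) ?ks) = r - card J"
    using J by (simp add: length_filter_conv_card card_Diff_subset finite_subset cong: conj_cong)
  moreover have "\<forall>k\<in>set (filter (\<lambda>k. 2 < k) ?ks). k = 3"
    using x by auto
  ultimately have "filter (\<lambda>k. 2 < k) ?ks = replicate (r - card J) 3"
    by (metis replicate_eqI)
  then show ?thesis
    unfolding W_def by (metis w_rec_filter)
qed

text \<open>Induction along the recurrence. At a gate, the local term of \<open>W_step\<close> pays
  for \<open>r - card J - 2\<close>, and the successor in direction \<open>i\<close>, where
  \<open>gate_sum\<close> vanishes, pays for the \<open>w_rec\<close> part of the gain.\<close>

lemma W_ge_gate_sum: "gate_sum r x \<le> W r x"
proof (induction "\<Sum>i<r. x i" arbitrary: x rule: less_induct)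
  case less
  have IH: "gate_sum r (x(i := x i - 1)) \<le> W r (x(i := x i - 1))" if "i \<in> active r x" for i
  proof (rule less.hyps)
    show "(\<Sum>l<r. (x(i := x i - 1)) l) < (\<Sum>l<r. x l)"
      using that by (intro sum_strict_mono_ex1) (auto simp: active_def)
  qed
  show ?case
  proof (cases "\<exists>p\<in>gates r. \<forall>i<r. x i = gate_point p i")
    case False
    then have "gate_sum r x \<le> (\<Sum>i\<in>active r x. gate_sum r (x(i := x i - 1)))"
      by (intro gate_sum_step_off_gates) blast
    also have "\<dots> \<le> (\<Sum>i\<in>active r x. W r (x(i := x i - 1)))"
      by (intro sum_mono IH)
    also have "\<dots> \<le> W r x"
      by (subst (2) W_step) simp
    finally show ?thesis .
  next
    case True
    then obtain J i where p: "(J, i) \<in> gates r" and x: "\<forall>l<r. x l = gate_point (J, i) l"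
      by (metis surj_pair)
    have J: "J \<subseteq> {..<r}" "card J < r - 2" and i: "i < r" "i \<notin> J"
      using p by (auto simp: gates_def)
    let ?x' = "\<lambda>l. x(l := x l - 1)"
    have act: "active r x = {..<r} - J"
      using x by (auto simp: active_def gate_point_def split: if_splits)
    then have card: "card (active r x) = r - card J"
      using J by (simp add: card_Diff_subset finite_subset)
    have cube: "?x' i l = (if l \<in> J then 0 else 1)" if "l < r" for l
      using x i that by (auto simp: gate_point_def)
    have "gate_sum r (?x' i) = 0"
      using cube by (intro gate_sum_unit_cube) auto
    moreover have "W r (?x' i) = real (w_rec (replicate (r - card J) 3))"
      using cube by (intro W_unit_cube J)
    moreover have "gate_sum r x \<le> (\<Sum>l\<in>active r x. gate_sum r (?x' l)) + gate_gain r (J, i)"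
      using p x by (rule gate_sum_step_at_gate)
    moreover have "W r x = (\<Sum>l\<in>active r x. W r (?x' l)) + real (card (active r x) - 2)"
      by (rule W_step)
    moreover have "real (card (active r x) - 2) = real r - real (card J) - 2"
      using J card by simp
    moreover have "(\<Sum>l\<in>active r x - {i}. gate_sum r (?x' l)) \<le> (\<Sum>l\<in>active r x - {i}. W r (?x' l))"
      by (intro sum_mono IH) auto
    moreover have "i \<in> active r x"
      using i act by simp
    ultimately show ?thesis
      by (simp add: gate_gain_def sum.remove[of _ i])
  qed
qed

section \<open>Contributions of the paths through the diagonal\<close>

definition staircase :: "nat \<Rightarrow> nat set \<Rightarrow> nat \<Rightarrow> nat" where
  "staircase c T l = (if l \<in> T then Suc c else c)"

lemma staircase_full: "l < r \<Longrightarrow> staircase c {..<r} l = staircase (Suc c) {} l"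
  by (simp add: staircase_def)

text \<open>\<open>fact t / fact s\<close> counts the ways to lower \<open>t\<close> raised
  coordinates one by one until \<open>s\<close> remain; the sum counts all visits before the
  diagonal is reached.\<close>

definition arrangements :: "nat \<Rightarrow> real" where
  "arrangements t = (\<Sum>s=1..t. fact t / fact s)"

lemma arrangements_Suc: "arrangements (Suc t) = real (Suc t) * arrangements t + 1"
  by (simp add: arrangements_def sum_distrib_left sum.nat_ivl_Suc' del: of_nat_Suc)

lemma arrangements_e_sum: "arrangements r = fact r * (e_sum r - 1)"
proof -
  have "e_sum r = 1 + (\<Sum>s=1..r. 1 / fact s)"
    by (simp add: e_sum_def sum.atLeast_Suc_atMost)
  then show ?thesis
    by (simp add: arrangements_def sum_distrib_left)
qed

text \<open>Away from gates the difference of \<open>W\<close> and \<open>gate_sum\<close> gains the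
  full local term \<open>r - 2\<close>. The last hypothesis keeps the staircase point away from the
  gates.\<close>

lemma excess_staircase_step:
  assumes "3 \<le> r" "1 \<le> c" "T \<subseteq> {..<r}" "2 \<le> c \<or> 2 \<le> card T"
  shows "(\<Sum>i\<in>T. W r (staircase c (T - {i})) - gate_sum r (staircase c (T - {i}))) + (real r - 2)
    \<le> W r (staircase c T) - gate_sum r (staircase c T)"
proof -
  let ?x = "staircase c T"
  let ?D = "\<lambda>x. W r x - gate_sum r x"
  have act: "active r ?x = {..<r}"
    using assms by (auto simp: active_def staircase_def)
  \<comment> \<open>A gate has a coordinate 1, which forces \<open>c = 1\<close>. Then the
    coordinates in \<open>T\<close> equal 2, but a gate has only one such coordinate.\<close>
  have "\<exists>i<r. ?x i \<noteq> gate_point p i" if p: "p \<in> gates r" for p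
  proof (rule ccontr)
    assume "\<not> ?thesis"
    then have eq: "?x i = gate_point p i" if "i < r" for i
      using that by blast
    have "fst p \<subseteq> {..<r}" "card (fst p) < r - 2"
      using p by (auto simp: gates_def)
    then have "card ({..<r} - fst p) > 2"
      by (simp add: card_Diff_subset finite_subset)
    then have "\<not> {..<r} - fst p \<subseteq> {snd p}"
      using card_mono[of "{snd p}" "{..<r} - fst p"] by auto
    then obtain l where l: "l < r" "l \<notin> fst p" "l \<noteq> snd p"
      by auto
    have "c = 1"
      using eq[OF l(1)] l assms(2) by (auto simp: gate_point_def staircase_def split: if_splits)
    then have "card T \<ge> 2"
      using assms(4) by simp
    moreover have "T \<subseteq> {snd p}"
    proof
      fix i assume "i \<in> T"
      then show "i \<in> {snd p}"
        using eq[of i] assms(3) \<open>c = 1\<close> by (auto simp: gate_point_def staircase_def split: if_splits)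
    qed
    ultimately show False
      using card_mono[of "{snd p}" T] by simp
  qed
  then have "gate_sum r ?x \<le> (\<Sum>i<r. gate_sum r (?x(i := ?x i - 1)))"
    using gate_sum_step_off_gates[of r ?x] act by simp
  moreover have "W r ?x = (\<Sum>i<r. W r (?x(i := ?x i - 1))) + (real r - 2)"
    using W_step[of r ?x] act assms(1) by simp
  ultimately have "(\<Sum>i<r. ?D (?x(i := ?x i - 1))) + (real r - 2) \<le> ?D ?x"
    by (simp add: sum_subtractf)
  \<comment> \<open>Steps leaving the staircase have nonnegative excess by
    \<open>W_ge_gate_sum\<close> and are dropped.\<close>
  moreover have "(\<Sum>i\<in>T. ?D (?x(i := ?x i - 1))) \<le> (\<Sum>i<r. ?D (?x(i := ?x i - 1)))"
    using assms(3) by (intro sum_mono2) (auto simp: W_ge_gate_sum)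
  moreover have "(\<Sum>i\<in>T. ?D (?x(i := ?x i - 1))) = (\<Sum>i\<in>T. ?D (staircase c (T - {i})))"
  proof (intro sum.cong refl)
    fix i assume "i \<in> T"
    then have "?x(i := ?x i - 1) = staircase c (T - {i})"
      by (auto simp: staircase_def fun_eq_iff)
    then show "?D (?x(i := ?x i - 1)) = ?D (staircase c (T - {i}))"
      by simp
  qed
  ultimately show ?thesis
    by linarith
qed

text \<open>The single-step hypothesis \<open>base\<close> is separate because for \<open>c = 1\<close> the points with one
  coordinate \<open>2\<close> are already accounted for in \<open>gate_sum\<close>; there it holds with
  \<open>B = - (r - 2)\<close>.\<close>

lemma excess_staircase:
  assumes "3 \<le> r" "1 \<le> c"
    and base: "\<And>i. i < r \<Longrightarrow>
      B + (real r - 2) \<le> W r (staircase c {i}) - gate_sum r (staircase c {i})"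
    and "T \<subseteq> {..<r}" "card T = Suc t"
  shows "B * fact (Suc t) + (real r - 2) * arrangements (Suc t)
    \<le> W r (staircase c T) - gate_sum r (staircase c T)"
  using assms(4,5)
proof (induction t arbitrary: T)
  case 0
  then obtain i where "T = {i}" "i < r"
    by (auto simp: card_1_singleton_iff)
  then show ?case
    using base by (simp add: arrangements_def)
next
  case (Suc t)
  let ?b = "B * fact (Suc t) + (real r - 2) * arrangements (Suc t)"
  have fin: "finite T"
    using Suc.prems finite_subset by blast
  \<comment> \<open>Each of the \<open>card T\<close> lowerings inherits \<open>?b\<close>, and the
    point itself adds \<open>r - 2\<close>; this matches \<open>arrangements_Suc\<close>.\<close>
  have "B * fact (Suc (Suc t)) + (real r - 2) * arrangements (Suc (Suc t))
      = real (card T) * ?b + (real r - 2)"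
    unfolding arrangements_Suc[of "Suc t"] fact_Suc[of "Suc t"] Suc.prems(2)
    by (simp add: algebra_simps del: fact_Suc)
  also have "real (card T) * ?b
      \<le> (\<Sum>i\<in>T. W r (staircase c (T - {i})) - gate_sum r (staircase c (T - {i})))"
    using Suc.prems fin by (intro sum_bounded_below Suc.IH) auto
  also have "\<dots> + (real r - 2) \<le> W r (staircase c T) - gate_sum r (staircase c T)"
    using Suc.prems assms(1,2) by (intro excess_staircase_step) auto
  finally show ?case
    by simp
qed

text \<open>The full staircase is the next diagonal point, and its coordinates can be lowered in
  \<open>fact r\<close> orders; so a bound \<open>B\<close> at one diagonal point is multiplied by
  \<open>fact r\<close>.\<close>

lemma excess_diagonal_step:
  assumes "3 \<le> r" "1 \<le> c"
    and base: "\<And>i. i < r \<Longrightarrow>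
      B + (real r - 2) \<le> W r (staircase c {i}) - gate_sum r (staircase c {i})"
  shows "B * fact r + (real r - 2) * arrangements r
    \<le> W r (staircase (Suc c) {}) - gate_sum r (staircase (Suc c) {})"
proof -
  have "B * fact r + (real r - 2) * arrangements r
     \<le> W r (staircase c {..<r}) - gate_sum r (staircase c {..<r})"
    using excess_staircase[OF assms, of "{..<r}" "r - 1"] assms(1) by simp
  also have "\<dots> = W r (staircase (Suc c) {}) - gate_sum r (staircase (Suc c) {})"
    using W_cong[of r, OF staircase_full] gate_sum_cong[of r, OF staircase_full] by simp
  finally show ?thesis .
qed

text \<open>Iterating B -> r! B + (r-2) r! (e_r - 1) gives a geometric sum; the starting value
  -(r-2) at the diagonal point of ones produces the term with \<open>- fact r ^ m\<close>.\<close>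

lemma excess_diagonal:
  assumes r: "3 \<le> r"
  shows "(real r - 2) * fact r * ((e_sum r - 1) * ((fact r ^ Suc m - 1) / (fact r - 1)) - fact r ^ m)
    \<le> W r (staircase (Suc (Suc m)) {}) - gate_sum r (staircase (Suc (Suc m)) {})"
proof (induction m)
  case 0
  have f: "fact r - 1 \<noteq> (0::real)"
    using r fact_mono[of 3 r, where 'a = real] by (simp add: eval_nat_numeral)
  \<comment> \<open>With this \<open>B\<close>, the single-step hypothesis is just nonnegativity of
    the excess.\<close>
  have "- (real r - 2) * fact r + (real r - 2) * arrangements r
    \<le> W r (staircase (Suc 1) {}) - gate_sum r (staircase (Suc 1) {})"
    using r by (intro excess_diagonal_step) (auto simp: W_ge_gate_sum)
  then show ?case
    using f by (simp add: arrangements_e_sum algebra_simps)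
next
  case (Suc m)
  have f: "fact r - 1 \<noteq> (0::real)"
    using r fact_mono[of 3 r, where 'a = real] by (simp add: eval_nat_numeral)
  let ?c = "Suc (Suc m)"
  define a where "a = real r - 2"
  define F :: real where "F = fact r"
  define E where "E = e_sum r - 1"
  define B where "B = a * F * (E * ((F ^ Suc m - 1) / (F - 1)) - F ^ m)"
  \<comment> \<open>From here on \<open>c\<close> is at least 2, so the points with one raised
    coordinate are no gates and also earn \<open>r - 2\<close>.\<close>
  have "B + (real r - 2) \<le> W r (staircase ?c {i}) - gate_sum r (staircase ?c {i})" if "i < r" for i
    using excess_staircase_step[of r ?c "{i}"] Suc.IH that r by (simp add: B_def a_def F_def E_def)
  then have "B * F + a * (F * E) \<le> W r (staircase (Suc ?c) {}) - gate_sum r (staircase (Suc ?c) {})"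
    using excess_diagonal_step[of r ?c B] r by (simp add: arrangements_e_sum a_def F_def E_def)
  moreover have "B * F + a * (F * E) = a * F * (E * ((F ^ Suc (Suc m) - 1) / (F - 1)) - F ^ Suc m)"
  proof -
    have "(F ^ Suc (Suc m) - 1) / (F - 1) = F * ((F ^ Suc m - 1) / (F - 1)) + 1"
      using f by (simp add: F_def field_simps)
    then show ?thesis
      by (simp add: B_def algebra_simps)
  qed
  ultimately show ?case
    by (simp add: a_def F_def E_def)
qed

section \<open>Evaluation at the diagonal\<close>

text \<open>The coordinates drop by \<open>m\<close> on \<open>J\<close>, by \<open>m - 2\<close> at
  \<open>i\<close> and by \<open>m - 1\<close> elsewhere, in total
  \<open>r * (m - 1) + card J - 1\<close>.\<close>

lemma paths_diagonal_gate:
  assumes p: "(J, i) \<in> gates r" and m: "2 \<le> m"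
  shows "paths r (staircase m {}) (gate_point (J, i))
    = multinomial (r * (m - 1) + card J - 1)
        (replicate (card J) m @ replicate (r - card J - 1) (m - 1) @ [m - 2])"
proof -
  let ?z = "gate_point (J, i)"
  define R where "R = {..<r} - J - {i}"
  have J: "J \<subseteq> {..<r}" "card J < r - 2" and i: "i < r" "i \<notin> J" and fin: "finite J"
    using p finite_subset by (auto simp: gates_def)
  have split: "{..<r} = insert i (J \<union> R)" and disj: "i \<notin> J \<union> R" "J \<inter> R = {}" "finite R"
    using J i by (auto simp: R_def)
  have cR: "card R = r - card J - 1"
    using J i fin by (simp add: R_def card_Diff_subset)
  have val: "m - ?z l = (if l \<in> J then m else if l = i then m - 2 else m - 1)" for l
    by (simp add: gate_point_def)
  have "(\<Prod>l<r. fact (m - ?z l)) = (fact (m - 2) * (fact m ^ card J * fact (m - 1) ^ card R) :: real)"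
  proof -
    have "(\<Prod>l\<in>J. fact (m - ?z l)) = (fact m ^ card J :: real)"
      by (simp add: val)
    moreover have "(\<Prod>l\<in>R. fact (m - ?z l)) = (\<Prod>l\<in>R. fact (m - 1) :: real)"
      by (intro prod.cong) (auto simp: val R_def)
    ultimately show ?thesis
      using disj fin i by (simp add: split prod.union_disjoint val)
  qed
  moreover have "(\<Sum>l<r. m - ?z l) = r * (m - 1) + card J - 1"
  proof -
    have "(\<Sum>l\<in>J. m - ?z l) = card J * m"
      by (simp add: val)
    moreover have "(\<Sum>l\<in>R. m - ?z l) = (\<Sum>l\<in>R. m - 1)"
      by (intro sum.cong) (auto simp: val R_def)
    ultimately have "(\<Sum>l<r. m - ?z l) = (m - 2) + (card J * m + card R * (m - 1))"
      using disj fin i by (simp add: split sum.union_disjoint val)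
    moreover obtain n where "m = Suc (Suc n)"
      using m by (metis add_2_eq_Suc le_Suc_ex)
    moreover have "r = Suc (card J + card R)"
      using cR J by simp
    ultimately show ?thesis
      by (simp add: algebra_simps)
  qed
  moreover have "\<forall>l<r. ?z l \<le> m"
    using m by (auto simp: gate_point_def)
  ultimately show ?thesis
    by (simp add: paths_def staircase_def multinomial_def cR algebra_simps)
qed

text \<open>From a diagonal point the summand depends only on \<open>j = card J\<close>; there are
  \<open>r choose j\<close> sets \<open>J\<close> and \<open>r - j\<close> positions for the
  2.\<close>

lemma gate_sum_diagonal:
  assumes m: "2 \<le> m"
  shows "gate_sum r (staircase m {}) = (\<Sum>j = 0..<r - 2. real (r choose j)
    * multinomial (r * (m - 1) + j - 1)
        (replicate j m @ replicate (r - j - 1) (m - 1) @ [m - 2])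
    * (real r - real j) * (real r - real j - 2 + real (w_rec (replicate (r - j) 3))))"
proof -
  let ?\<J> = "{J. J \<subseteq> {..<r} \<and> card J < r - 2}"
  define mu where "mu j = multinomial (r * (m - 1) + j - 1)
        (replicate j m @ replicate (r - j - 1) (m - 1) @ [m - 2])" for j
  define g where "g j = real r - real j - 2 + real (w_rec (replicate (r - j) 3))" for j
  have "gate_sum r (staircase m {}) = (\<Sum>(J, i)\<in>gates r. mu (card J) * g (card J))"
    unfolding gate_sum_def
    by (intro sum.cong refl) (auto simp: paths_diagonal_gate[OF _ m] mu_def g_def gate_gain_def)
  also have "\<dots> = (\<Sum>J\<in>?\<J>. \<Sum>i\<in>{..<r} - J. mu (card J) * g (card J))"
    unfolding gates_def by (intro sum.Sigma[symmetric]) auto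
  also have "\<dots> = (\<Sum>J\<in>?\<J>. mu (card J) * (real r - real (card J)) * g (card J))"
  proof (intro sum.cong refl)
    fix J assume J: "J \<in> ?\<J>"
    then have "card ({..<r} - J) = r - card J" "card J \<le> r"
      by (auto simp: card_Diff_subset finite_subset)
    then have "real (card ({..<r} - J)) = real r - real (card J)"
      by simp
    then show "(\<Sum>i\<in>{..<r} - J. mu (card J) * g (card J))
        = mu (card J) * (real r - real (card J)) * g (card J)"
      by simp
  qed
  also have "\<dots> = (\<Sum>j\<in>{0..<r - 2}. \<Sum>J\<in>{J \<in> ?\<J>. card J = j}.
      mu (card J) * (real r - real (card J)) * g (card J))"
    by (intro sum.group[symmetric]) auto
  also have "\<dots> = (\<Sum>j\<in>{0..<r - 2}. real (r choose j) * mu j * (real r - real j) * g j)"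
  proof (intro sum.cong refl)
    fix j assume "j \<in> {0..<r - 2}"
    then have "{J \<in> ?\<J>. card J = j} = {J. J \<subseteq> {..<r} \<and> card J = j}"
      by auto
    then have "card {J \<in> ?\<J>. card J = j} = r choose j"
      by (simp add: n_subsets)
    then show "(\<Sum>J\<in>{J \<in> ?\<J>. card J = j}. mu (card J) * (real r - real (card J)) * g (card J))
        = real (r choose j) * mu j * (real r - real j) * g j"
      by simp
  qed
  finally show ?thesis
    by (simp add: mu_def g_def)
qed

theorem theorem3p7:
  fixes w :: "nat \<Rightarrow> nat list \<Rightarrow> nat" and r k :: nat
  assumes "w_family w" and "r \<ge> 2" and "k \<ge> 4"
  shows "real (w r (replicate r k)) \<ge>
    (real r - 2) * fact r *
      ((e_sum r - 1) * ((fact r ^ (k - 3) - 1) / (fact r - 1)) - fact r ^ (k - 4))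
    + (\<Sum>j = 0..<r - 2.
        real (r choose j)
        * multinomial (r * (k - 3) + j - 1)
            (replicate j (k - 2) @ replicate (r - j - 1) (k - 3) @ [k - 4])
        * (real r - real j)
        * (real r - real j - 2 + real (w (r - j) (replicate (r - j) 3))))"
proof (cases "r = 2")
  \<comment> \<open>Both parts of the bound vanish: the factor \<open>r - 2\<close> is 0 and the sum
    is empty.\<close>
  case True
  then show ?thesis
    by simp
next
  case False
  then have r: "3 \<le> r"
    using assms(2) by simp
  \<comment> \<open>After the shift by 2 the diagonal point has coordinates
    \<open>k - 2 = Suc (Suc m)\<close>.\<close>
  obtain m where k: "k = Suc (Suc (Suc (Suc m)))"
    using assms(3) by (intro that[of "k - 4"]) simp
  have w: "w n (replicate n l) = w_rec (replicate n l)" if "2 \<le> n" "2 \<le> l" for n l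
    using that by (intro w_family_unique[OF assms(1) w_family_exists]) auto
  have "W r (staircase (Suc (Suc m)) {}) = real (w r (replicate r k))"
    using w[of r k] r k by (simp add: W_def staircase_def map_replicate_const)
  moreover have "(\<Sum>j = 0..<r - 2. real (r choose j)
        * multinomial (r * (k - 3) + j - 1)
            (replicate j (k - 2) @ replicate (r - j - 1) (k - 3) @ [k - 4])
        * (real r - real j)
        * (real r - real j - 2 + real (w (r - j) (replicate (r - j) 3))))
     = gate_sum r (staircase (Suc (Suc m)) {})"
    by (subst gate_sum_diagonal, simp, intro sum.cong refl) (simp add: w k)
  moreover have "k - 3 = Suc m" "k - 4 = m"
    using k by auto
  ultimately show ?thesis
    using excess_diagonal[OF r, of m] by simp
qed

end
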